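(* For all $n\ge1$, the vertex connectivity of the parity-constrained Hanoi graph satisfies $\kappa(P^n)=2$.
   Context: Let $Q=\{0,1,2,3\}$ (pegs: $0,3$ neutral; $1$ reserved for even discs; $2$ reserved for odd discs). For a disc $d\in\{1,\dots,n\}$ let $p(d)=1$ if $d$ is even and $p(d)=2$ if $d$ is odd, and $Q^d=\{0,p(d),3\}$. The vertices of $P^n$ are words $s=s_n\cdots s_1\in Q^n$ ($s_d$ is the peg of disc $d$) with $s_d\in Q^d$ for all $d$. Two vertices are adjacent iff they differ in exactly one coordinate $d$, with values $i\ne j$ there, $i,j\in Q^d$, and $s_k\notin\{i,j\}$ for all $k<d$. *)

theory Defs
  imports "Graph_Theory.Graph_Theory" "HOL-Library.FuncSet"
begin

definition reserved_peg :: "nat \<Rightarrow> nat" where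
  "reserved_peg d = (if even d then 1 else 2)"

definition disc_pegs :: "nat \<Rightarrow> nat set" where
  "disc_pegs d = {0, reserved_peg d, 3}"

text \<open>A word \<open>s\<^sub>n \<dots> s\<^sub>1\<close> is the extensional function \<open>d \<mapsto> s\<^sub>d\<close> on the discs \<open>{1..n}\<close>;
  disc 1 is the smallest.\<close>

definition parity_words :: "nat \<Rightarrow> (nat \<Rightarrow> nat) set" where
  "parity_words n = (\<Pi>\<^sub>E d\<in>{1..n}. disc_pegs d)"

text \<open>Each undirected edge is represented by its two opposite arcs, see
  \<open>pair_graph_parity_hanoi\<close> below.\<close>

definition parity_hanoi :: "nat \<Rightarrow> (nat \<Rightarrow> nat) pair_pre_digraph" where
  "parity_hanoi n = \<lparr>
     pverts = parity_words n,
     parcs = {(s, t). s \<in> parity_words n \<and> t \<in> parity_words n \<and>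
       (\<exists>d\<in>{1..n}. s d \<noteq> t d \<and> (\<forall>k\<in>{1..n} - {d}. s k = t k) \<and>
          (\<forall>k\<in>{1..<d}. s k \<notin> {s d, t d}))} \<rparr>"

text \<open>The least number of vertices whose removal leaves a disconnected graph or a single vertex;
  hence \<open>m - 1\<close> for the complete graph on \<open>m \<ge> 1\<close> vertices. Connectedness is that of the
  underlying undirected graph. The least number exists for every finite graph; the library calls the
  empty graph not connected, but for a nonempty graph removing all vertices is never optimal.\<close>

definition vertex_connectivity :: "('a, 'b) pre_digraph \<Rightarrow> nat" where
  "vertex_connectivity G =
     (LEAST k. \<exists>S \<subseteq> verts G. finite S \<and> card S = k \<and>
        (\<not> Digraph_Component.connected (G \<restriction> (verts G - S)) \<or> card (verts G - S) = 1))"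

lemma pair_graph_parity_hanoi: "pair_graph (parity_hanoi n)"
proof -
  have fin: "finite (parity_words n)"
    unfolding parity_words_def disc_pegs_def by (rule finite_PiE) simp_all
  have sub: "parcs (parity_hanoi n) \<subseteq> parity_words n \<times> parity_words n"
    by (auto simp: parity_hanoi_def)
  have fin2: "finite (parcs (parity_hanoi n))"
    by (rule finite_subset[OF sub]) (simp add: fin)
  have pv: "pverts (parity_hanoi n) = parity_words n"
    by (simp add: parity_hanoi_def)
  have irrefl: "s \<noteq> t" if "(s, t) \<in> parcs (parity_hanoi n)" for s t
    using that unfolding parity_hanoi_def by auto
  have sym: "(t, s) \<in> parcs (parity_hanoi n)" if st: "(s, t) \<in> parcs (parity_hanoi n)" for s t
  proof -
    from st obtain d where d: "s \<in> parity_words n" "t \<in> parity_words n" "d \<in> {1..n}" "s d \<noteq> t d"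
      "\<forall>k\<in>{1..n} - {d}. s k = t k" "\<forall>k\<in>{1..<d}. s k \<notin> {s d, t d}"
      unfolding parity_hanoi_def by auto
    have "\<forall>k\<in>{1..n} - {d}. t k = s k" "t d \<noteq> s d" using d(4,5) by simp_all
    moreover have "\<forall>k\<in>{1..<d}. t k \<notin> {t d, s d}"
    proof
      fix k assume k: "k \<in> {1..<d}"
      then have "s k = t k" using d(3,5) by simp
      then show "t k \<notin> {t d, s d}" using d(6) k by fastforce
    qed
    ultimately have "\<exists>d\<in>{1..n}. t d \<noteq> s d \<and> (\<forall>k\<in>{1..n} - {d}. t k = s k) \<and>
        (\<forall>k\<in>{1..<d}. t k \<notin> {t d, s d})"
      by (intro bexI[OF _ d(3)] conjI)
    then show ?thesis using d(1,2) unfolding parity_hanoi_def by simp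
  qed
  show ?thesis
  proof
    fix e assume e: "e \<in> parcs (parity_hanoi n)"
    show "fst e \<in> pverts (parity_hanoi n)" "snd e \<in> pverts (parity_hanoi n)"
      using e sub pv by auto
    show "fst e \<noteq> snd e" using e irrefl by (cases e) auto
  next
    show "symmetric (with_proj (parity_hanoi n))"
      unfolding symmetric_def by (rule symI) (simp add: sym)
  qed (simp_all add: fin fin2 pv)
qed

end

theory Submission
  imports Defs
begin

text \<open>Fixing the peg of the largest disc splits \<open>P\<^sup>n\<^sup>+\<^sup>1\<close> into three copies of \<open>P\<^sup>n\<close>, and each pair of
  copies is joined by an edge. For \<open>n \<ge> 1\<close> the edges leaving a given copy can be chosen with distinct
  endpoints in it, so after deleting one vertex every copy still reaches the other two; by induction
  \<open>P\<^sup>n\<close> has no cut vertex. Conversely, when all discs are on peg \<open>0\<close> only disc 1 can move, so this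
  vertex has just two neighbours.\<close>

text \<open>Arcs come in opposite pairs, so symmetrising the induced subgraph adds none. Plain
  \<open>rtrancl\<close> also relates words outside \<open>W\<close> to themselves, which is
  harmless since \<open>u\<close> and \<open>v\<close> range over \<open>W\<close>.\<close>

lemma connected_induce_subgraph_iff:
  assumes "pair_graph G"
  shows "Digraph_Component.connected (with_proj G \<restriction> W) \<longleftrightarrow>
    W \<noteq> {} \<and> (\<forall>u\<in>W. \<forall>v\<in>W. (u, v) \<in> (Restr (parcs G) W)\<^sup>*)"
proof -
  interpret pair_graph G by (rule assms)
  have "sym (parcs G)"
    using sym_arcs by (simp add: symmetric_def)
  then have "parcs (mk_symmetric (with_proj G \<restriction> W)) = Restr (parcs G) W"
    by (auto simp: parcs_mk_symmetric dest: symD)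
  moreover have "(u, v) \<in> rtrancl_on W (Restr (parcs G) W) \<longleftrightarrow> (u, v) \<in> (Restr (parcs G) W)\<^sup>*"
    if "u \<in> W" "v \<in> W" for u v
    using that by (auto intro: rtrancl_on_rtranclI rtrancl_consistent_rtrancl_on)
  ultimately show ?thesis
    by (auto simp: Digraph_Component.connected_def strongly_connected_def reachable_def)
qed

lemma parity_words_Suc_upd:
  assumes "s \<in> parity_words n" "i \<in> disc_pegs (Suc n)"
  shows "s(Suc n := i) \<in> parity_words (Suc n)"
  using assms by (auto simp: parity_words_def PiE_iff extensional_def le_Suc_eq)

lemma parity_words_SucE:
  assumes "x \<in> parity_words (Suc n)"
  obtains s i where "s \<in> parity_words n" "i \<in> disc_pegs (Suc n)" "x = s(Suc n := i)"
proof
  show "x(Suc n := undefined) \<in> parity_words n" "x (Suc n) \<in> disc_pegs (Suc n)"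
    "x = (x(Suc n := undefined))(Suc n := x (Suc n))"
    using assms by (auto simp: parity_words_def PiE_iff extensional_def)
qed

text \<open>Only smaller discs block a move, so a new largest disc obstructs nothing, whatever its
  peg.\<close>

lemma parcs_Suc_upd:
  assumes "(s, t) \<in> parcs (parity_hanoi n)" "i \<in> disc_pegs (Suc n)"
  shows "(s(Suc n := i), t(Suc n := i)) \<in> parcs (parity_hanoi (Suc n))"
proof -
  obtain d where st: "s \<in> parity_words n" "t \<in> parity_words n"
    and d: "d \<in> {1..n}" "s d \<noteq> t d" "\<forall>k\<in>{1..n} - {d}. s k = t k" "\<forall>k\<in>{1..<d}. s k \<notin> {s d, t d}"
    using assms(1) by (auto simp: parity_hanoi_def)
  have "\<exists>d\<in>{1..Suc n}. (s(Suc n := i)) d \<noteq> (t(Suc n := i)) d \<and>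
      (\<forall>k\<in>{1..Suc n} - {d}. (s(Suc n := i)) k = (t(Suc n := i)) k) \<and>
      (\<forall>k\<in>{1..<d}. (s(Suc n := i)) k \<notin> {(s(Suc n := i)) d, (t(Suc n := i)) d})"
    by (rule bexI[of _ d]) (use d in auto)
  then show ?thesis
    using st assms(2) by (simp add: parity_hanoi_def parity_words_Suc_upd)
qed

text \<open>No single reserved peg admits discs of both parities. For \<open>c\<close> outside {0,
  3} the discs are therefore spread over pegs 1 and 2 by parity, which still keeps 0 and 3
  free.\<close>

definition stack :: "nat \<Rightarrow> nat \<Rightarrow> nat \<Rightarrow> nat" where
  "stack n c = (\<lambda>k\<in>{1..n}. if c \<in> {0, 3} then c else reserved_peg k)"

lemma stack_in_parity_words: "stack n c \<in> parity_words n"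
  by (auto simp: stack_def parity_words_def disc_pegs_def)

text \<open>Disc 1 lies on 0, 3 or 2 according as \<open>c\<close> is 0, 3 or reserved, and
  \<open>disc_pegs d\<close> has only one reserved peg. This makes bridge endpoints within one copy
  distinct.\<close>

lemma stack_inj:
  assumes "stack n a = stack n b" "n \<ge> 1" "a \<in> disc_pegs d" "b \<in> disc_pegs d"
  shows "a = b"
  using fun_cong[OF assms(1), of 1] assms(2-)
  by (auto simp: stack_def disc_pegs_def reserved_peg_def split: if_splits)

text \<open>The smaller discs stacked on the third peg \<open>c\<close> (on their reserved pegs if \<open>c\<close> is the reserved
  peg of the largest disc) leave \<open>i\<close> and \<open>j\<close> free.\<close>

lemma stack_bridge:
  assumes "disc_pegs (Suc n) = {i, j, c}" "i \<noteq> j" "c \<noteq> i" "c \<noteq> j"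
  shows "((stack n c)(Suc n := i), (stack n c)(Suc n := j)) \<in> parcs (parity_hanoi (Suc n))"
proof -
  have free: "stack n c k \<notin> {i, j}" if "k \<in> {1..n}" for k
  proof (cases "c \<in> {0, 3}")
    case True
    then show ?thesis using that assms by (simp add: stack_def)
  next
    case False
    moreover have "c \<in> disc_pegs (Suc n)" "{i, j} = disc_pegs (Suc n) - {c}"
      using assms by auto
    ultimately have "c = reserved_peg (Suc n)" "{i, j} = {0, reserved_peg (Suc n), 3} - {c}"
      by (simp_all add: disc_pegs_def)
    moreover have "{0, reserved_peg (Suc n), 3} - {reserved_peg (Suc n)} = {0, 3}"
      by (auto simp: reserved_peg_def)
    ultimately have "{i, j} = {0, 3}" by simp
    then show ?thesis using that False by (auto simp: stack_def reserved_peg_def)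
  qed
  have "\<exists>d\<in>{1..Suc n}. ((stack n c)(Suc n := i)) d \<noteq> ((stack n c)(Suc n := j)) d \<and>
      (\<forall>k\<in>{1..Suc n} - {d}. ((stack n c)(Suc n := i)) k = ((stack n c)(Suc n := j)) k) \<and>
      (\<forall>k\<in>{1..<d}. ((stack n c)(Suc n := i)) k \<notin>
        {((stack n c)(Suc n := i)) d, ((stack n c)(Suc n := j)) d})"
    by (rule bexI[of _ "Suc n"]) (use free assms(2) in auto)
  then show ?thesis
    using assms(1) by (simp add: parity_hanoi_def parity_words_Suc_upd stack_in_parity_words)
qed

lemma disc_pegs_third:
  assumes "i \<in> disc_pegs d" "j \<in> disc_pegs d" "i \<noteq> j"
  obtains c where "disc_pegs d = {i, j, c}" "c \<noteq> i" "c \<noteq> j"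
proof -
  have "card (disc_pegs d) = 3"
    by (simp add: disc_pegs_def reserved_peg_def)
  then have "card (disc_pegs d - {i, j}) = 1"
    using assms by (simp add: card_Diff_subset)
  then obtain c where "disc_pegs d - {i, j} = {c}"
    by (rule card_1_singletonE)
  then show ?thesis
    using assms by (intro that[of c]) blast+
qed

text \<open>Deleting at most one word, not necessarily a vertex, treats the copies with and without a
  deleted vertex uniformly in the induction.\<close>

lemma parity_hanoi_no_cut_vertex:
  assumes "\<And>a b. a \<in> S \<Longrightarrow> b \<in> S \<Longrightarrow> a = b"
    and "x \<in> parity_words n - S" "y \<in> parity_words n - S"
  shows "(x, y) \<in> (Restr (parcs (parity_hanoi n)) (parity_words n - S))\<^sup>*"
  using assms
proof (induction n arbitrary: S x y)
  case 0
  then have "x = y" by (simp add: parity_words_def)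
  then show ?case by simp
next
  case (Suc n)
  let ?D = "disc_pegs (Suc n)"
  let ?W = "parity_words (Suc n) - S"
  let ?R = "Restr (parcs (parity_hanoi (Suc n))) ?W"
  let ?b = "\<lambda>c i. (stack n c)(Suc n := i)"
  have copy: "(s(Suc n := i), t(Suc n := i)) \<in> ?R\<^sup>*"
    if "s \<in> parity_words n" "t \<in> parity_words n" "i \<in> ?D" "s(Suc n := i) \<notin> S" "t(Suc n := i) \<notin> S"
    for s t i
  proof -
    \<comment> \<open>The trace of \<open>S\<close> on copy \<open>i\<close>. It again has at most
      one element: words on \<open>n\<close> discs are all \<open>undefined\<close> at
      \<open>Suc n\<close>, so placing the new disc is injective.\<close>
    let ?S = "{u \<in> parity_words n. u(Suc n := i) \<in> S}"
    have eq: "u = v" if "u \<in> ?S" "v \<in> ?S" for u v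
    proof
      fix k
      have "u(Suc n := i) = v(Suc n := i)" using that Suc.prems(1) by blast
      moreover have "u (Suc n) = v (Suc n)"
        using that by (auto simp: parity_words_def PiE_iff extensional_def)
      ultimately show "u k = v k" by (metis fun_upd_apply)
    qed
    have "(s, t) \<in> (Restr (parcs (parity_hanoi n)) (parity_words n - ?S))\<^sup>*"
      using eq by (rule Suc.IH) (use that in auto)
    then show ?thesis
    proof (induction rule: rtrancl_induct)
      case (step u v)
      then have "(u(Suc n := i), v(Suc n := i)) \<in> ?R"
        using \<open>i \<in> ?D\<close> by (auto intro: parcs_Suc_upd parity_words_Suc_upd)
      with step.IH show ?case by (rule rtrancl_into_rtrancl)
    qed simp
  qed
  have bridge: "(?b c i, ?b c j) \<in> ?R\<^sup>*"
    if "?D = {i, j, c}" "i \<noteq> j" "c \<noteq> i" "c \<noteq> j" "?b c i \<notin> S" "?b c j \<notin> S" for i j c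
    using stack_bridge[OF that(1-4)] that
    by (intro r_into_rtrancl) (auto intro: parity_words_Suc_upd stack_in_parity_words)
  obtain s i where s: "s \<in> parity_words n" "i \<in> ?D" "x = s(Suc n := i)"
    using Suc.prems(2) by (auto elim: parity_words_SucE)
  obtain t j where t: "t \<in> parity_words n" "j \<in> ?D" "y = t(Suc n := j)"
    using Suc.prems(3) by (auto elim: parity_words_SucE)
  have xy: "s(Suc n := i) \<notin> S" "t(Suc n := j) \<notin> S"
    using Suc.prems(2,3) s(3) t(3) by blast+
  note bw = stack_in_parity_words[of n]
  show ?case
  proof (cases "i = j")
    case True
    then show ?thesis using copy[OF s(1) t(1) s(2)] s(3) t(3) xy by blast
  next
    case False
    obtain c where c: "?D = {i, j, c}" "c \<noteq> i" "c \<noteq> j"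
      using disc_pegs_third[OF s(2) t(2) False] .
    have cD: "c \<in> ?D" using c by simp
    show ?thesis
    \<comment> \<open>The direct bridge from copy \<open>i\<close> to copy \<open>j\<close> has the
      smaller discs stacked for \<open>c\<close>. If one of its ends is deleted, the path detours
      through copy \<open>c\<close>.\<close>
    proof (cases "?b c i \<in> S \<or> ?b c j \<in> S")
      case False
      have "(x, ?b c i) \<in> ?R\<^sup>*" using copy[OF s(1) bw s(2)] s xy False by simp
      also have "(?b c i, ?b c j) \<in> ?R\<^sup>*" using bridge c \<open>i \<noteq> j\<close> False by blast
      also have "(?b c j, y) \<in> ?R\<^sup>*" using copy[OF bw t(1,2)] t xy False by simp
      finally show ?thesis .
    next
      case True
      \<comment> \<open>For \<open>n = 0\<close> the bridge ends would be \<open>x\<close> and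
        \<open>y\<close> themselves, which are not deleted.\<close>
      have "n \<ge> 1"
      proof (rule ccontr)
        assume "\<not> n \<ge> 1"
        then have "stack n c = s" "stack n c = t"
          using s t bw[of c] by (auto simp: parity_words_def)
        then show False using True xy by auto
      qed
      \<comment> \<open>The only deleted word carries the stack for \<open>c\<close>, whereas the
        four ends of the two detour bridges carry those for \<open>j\<close> and
        \<open>i\<close>.\<close>
      have avoid: "?b a k \<notin> S"
        if "(a, k) \<in> {(j, i), (j, c), (i, c), (i, j)}" for a k
      proof
        assume "?b a k \<in> S"
        then obtain l where l: "l \<in> {i, j}" "?b a k = ?b c l"
          using True Suc.prems(1) by blast
        have "k = l" using fun_cong[OF l(2), of "Suc n"] by simp
        moreover have "stack n a = stack n c"
        proof
          fix m show "stack n a m = stack n c m"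
            using fun_cong[OF l(2), of m] by (cases "m = Suc n") (auto simp: stack_def)
        qed
        then have "a = c"
          using stack_inj[of n a c "Suc n"] \<open>n \<ge> 1\<close> cD s(2) t(2) that by auto
        ultimately show False using that l c by auto
      qed
      have D': "?D = {i, c, j}" "?D = {c, j, i}" using c by auto
      have "(x, ?b j i) \<in> ?R\<^sup>*" using copy[OF s(1) bw s(2)] s xy avoid by simp
      also have "(?b j i, ?b j c) \<in> ?R\<^sup>*" using bridge[OF D'(1)] c \<open>i \<noteq> j\<close> avoid by simp
      also have "(?b j c, ?b i c) \<in> ?R\<^sup>*" using copy[OF bw bw cD] avoid by simp
      also have "(?b i c, ?b i j) \<in> ?R\<^sup>*" using bridge[OF D'(2)] c \<open>i \<noteq> j\<close> avoid by simp
      also have "(?b i j, y) \<in> ?R\<^sup>*" using copy[OF bw t(1,2)] t xy avoid by simp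
      finally show ?thesis .
    qed
  qed
qed

lemma card_parity_words: "card (parity_words n) = 3 ^ n"
proof -
  have "card (disc_pegs d) = 3" for d
    by (simp add: disc_pegs_def reserved_peg_def)
  then show ?thesis by (simp add: parity_words_def card_PiE)
qed

text \<open>A larger disc would have to leave peg 0, where disc 1 lies. So disc 1 moves, and its
  other pegs are 2 and 3.\<close>

lemma stack_zero_neighbours:
  assumes "(stack n 0, t) \<in> parcs (parity_hanoi n)"
  shows "t \<in> {(stack n 0)(1 := 2), (stack n 0)(1 := 3)}"
proof -
  let ?z = "stack n 0"
  obtain d where t: "t \<in> parity_words n"
    and d: "d \<in> {1..n}" "?z d \<noteq> t d" "\<forall>k\<in>{1..n} - {d}. ?z k = t k" "\<forall>k\<in>{1..<d}. ?z k \<notin> {?z d, t d}"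
    using assms by (auto simp: parity_hanoi_def)
  have "d = 1"
  proof (rule ccontr)
    assume "d \<noteq> 1"
    then have "1 \<in> {1..<d}" using d(1) by simp
    then show False using d(1,4) by (fastforce simp: stack_def)
  qed
  have "t 1 \<in> {2, 3}"
    using PiE_mem[OF t[unfolded parity_words_def] d(1)] d(1,2) \<open>d = 1\<close>
    by (auto simp: disc_pegs_def reserved_peg_def stack_def)
  moreover have "t = ?z(1 := t 1)"
  proof
    fix k show "t k = (?z(1 := t 1)) k"
      using d(3) \<open>d = 1\<close> t by (cases "k \<in> {1..n}") (auto simp: parity_words_def stack_def)
  qed
  ultimately show ?thesis by auto
qed

theorem theorem6p9:
  fixes n :: nat
  assumes "n \<ge> 1"
  shows "vertex_connectivity (with_proj (parity_hanoi n)) = 2"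
proof -
  let ?G = "parity_hanoi n" and ?V = "parity_words n"
  have V: "verts (with_proj ?G) = ?V" by (simp add: parity_hanoi_def)
  note conn = connected_induce_subgraph_iff[OF pair_graph_parity_hanoi]
  have three: "3 \<le> card ?V"
    using assms power_increasing[of 1 n "3::nat"] by (simp add: card_parity_words)
  show ?thesis
    unfolding vertex_connectivity_def V
  proof (rule Least_equality)
    let ?z = "stack n 0"
    let ?S = "{?z(1 := 2), ?z(1 := 3)}"
    have neq: "?z(1 := 2) \<noteq> ?z(1 := 3)" by (metis fun_upd_same numeral_eq_iff num.distinct(5) semiring_norm(88))
    have "?S \<subseteq> ?V"
      using assms by (auto simp: stack_def parity_words_def PiE_iff extensional_def disc_pegs_def reserved_peg_def)
    moreover have "card ?S = 2" using neq by simp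
    \<comment> \<open>Without its two neighbours \<open>?z\<close> is isolated, so a connected
      remainder can only be \<open>?z\<close> alone. This happens for the triangle
      \<open>n = 1\<close>; for larger \<open>n\<close> the remainder is disconnected.\<close>
    moreover have "card (?V - ?S) = 1" if "Digraph_Component.connected (with_proj ?G \<restriction> (?V - ?S))"
    proof -
      have "?z 1 = 0" using assms by (simp add: stack_def)
      then have "?z \<notin> ?S" by (metis fun_upd_same insertE singletonD zero_neq_numeral)
      then have z: "?z \<in> ?V - ?S" by (simp add: stack_in_parity_words)
      have "w = ?z" if "w \<in> ?V - ?S" for w
      proof -
        have "(?z, w) \<in> (Restr (parcs ?G) (?V - ?S))\<^sup>*"
          using conn \<open>connected _\<close> z that by blast
        then show ?thesis
          by (cases rule: converse_rtranclE) (auto dest: stack_zero_neighbours)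
      qed
      then have "?V - ?S = {?z}"
        using z by (intro subset_antisym subsetI) (simp_all only: singleton_iff)
      then show ?thesis by simp
    qed
    ultimately show "\<exists>S\<subseteq>?V. finite S \<and> card S = 2 \<and>
        (\<not> Digraph_Component.connected (with_proj ?G \<restriction> (?V - S)) \<or> card (?V - S) = 1)"
      by (intro exI[of _ ?S]) auto
  next
    fix k
    assume "\<exists>S\<subseteq>?V. finite S \<and> card S = k \<and>
        (\<not> Digraph_Component.connected (with_proj ?G \<restriction> (?V - S)) \<or> card (?V - S) = 1)"
    then obtain S where S: "S \<subseteq> ?V" "finite S" "card S = k"
      "\<not> Digraph_Component.connected (with_proj ?G \<restriction> (?V - S)) \<or> card (?V - S) = 1" by blast
    show "2 \<le> k"
    proof (rule ccontr)
      assume "\<not> 2 \<le> k"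
      then have le: "card S \<le> Suc 0" using S(3) by simp
      then have "a = b" if "a \<in> S" "b \<in> S" for a b
        using that S(2) by (auto simp: card_le_Suc0_iff_eq)
      then have "\<forall>u\<in>?V - S. \<forall>v\<in>?V - S. (u, v) \<in> (Restr (parcs ?G) (?V - S))\<^sup>*"
        using parity_hanoi_no_cut_vertex by blast
      \<comment> \<open>At least three vertices minus at most one: this rules out the single-vertex
        alternative and the empty graph.\<close>
      moreover have "2 \<le> card (?V - S)"
        using card_Diff_subset[OF S(2,1)] three le by simp
      moreover from this have "?V - S \<noteq> {}" by fastforce
      ultimately show False using S(4) conn by simp
    qed
  qed
qed

end
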